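(* Consider the risk-averse optimal stopping problem with horizon $T$, state space $\mathcal X\subseteq\mathbb R^n$, transition kernels $Q_t$, stopping costs $s_t$, continuation costs $c_t$ and one-step risk measures $\rho_t$, where each $\rho_t$ is coherent and distribution-invariant. Let $L_t$ be the continuation loss and $M_t$ the one-step loss ($0\le t\le T-1$). Suppose that for each $t=0,\dots,T-2$ and each $x\in\mathcal X$: if $M_t(x)\ge0$, then $M_{t+1}(\tilde X_{t+1}(x))\ge0$ almost surely. Then, for every $t=0,\dots,T-1$, $M_t$ and $L_t$ have the same sign, i.e. for each $x\in\mathcal X$ the numbers $M_t(x)$ and $L_t(x)$ are both positive, both zero, or both negative. Consequently, the one-step look-ahead policy $\overline d=(\overline d_0,\dots,\overline d_{T-1})$ defined by $\overline d_t(x)=S$ if $M_t(x)\ge0$ and $\overline d_t(x)=C$ if $M_t(x)<0$ is optimal.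
   Context: Setting. $T\ge 1$ is an integer and $\mathcal X\subseteq\mathbb R^n$ is a measurable set. For $t=0,\dots,T-1$, $Q_t(\cdot\mid x)$ is a Markov transition kernel on $\mathcal X$, and $\tilde X_{t+1}(x)$ denotes an $\mathcal X$-valued random vector with law $Q_t(\cdot\mid x)$. The functions $s_t:\mathcal X\to\mathbb R$ ($0\le t\le T$) and $c_t:\mathcal X\to\mathbb R$ ($0\le t\le T-1$) are measurable: stopping at time $t$ in state $x$ costs $s_t(x)$ and ends the process; continuing costs $c_t(x)$ and moves the state to $\tilde X_{t+1}(x)$. Risk measures. Let $\mathcal Z$ be a linear space of real random variables on an atomless probability space, containing the constants and closed under equality in law. For $t=0,\dots,T-1$, $\rho_t:\mathcal Z\to\mathbb R$ is coherent: (convexity) $\rho_t(\lambda Z+(1-\lambda)W)\le\lambda\rho_t(Z)+(1-\lambda)\rho_t(W)$ for $\lambda\in[0,1]$; (monotonicity) $Z\le W$ a.s. implies $\rho_t(Z)\le\rho_t(W)$; (translation invariance) $\rho_t(a+W)=a+\rho_t(W)$ for constants $a$; (positive homogeneity) $\rho_t(\lambda W)=\lambda\rho_t(W)$ for $\lambda\ge0$. It is distribution-invariant: $\rho_t(Z)=\rho_t(W)$ whenever $Z$ and $W$ have the same law. Value functions and losses. $v_T(x)=s_T(x)$ and, for $t<T$, $v_t(x)=\min\{s_t(x),\,c_t(x)+\rho_t(v_{t+1}(\tilde X_{t+1}(x)))\}$. For $t=0,\dots,T-1$, $$L_t(x)=\rho_t(v_{t+1}(\tilde X_{t+1}(x)))+c_t(x)-s_t(x),\qquad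 M_t(x)=\rho_t(s_{t+1}(\tilde X_{t+1}(x)))+c_t(x)-s_t(x).$$ Policies. A policy is $d=(d_0,\dots,d_{T-1})$ with $d_t:\mathcal X\to\{S,C\}$ measurable ($S$ = stop, $C$ = continue). Its risk $J(d,x)=J^d_0(x)$ is given by $J^d_T=s_T$ and, for $t<T$, $J^d_t(x)=s_t(x)$ if $d_t(x)=S$, $J^d_t(x)=c_t(x)+\rho_t(J^d_{t+1}(\tilde X_{t+1}(x)))$ if $d_t(x)=C$. A policy $d^*$ is optimal if $J(d^*,x)=\min_dJ(d,x)$ for all $x\in\mathcal X$. It is assumed that all functions involved are measurable and that all random variables to which $\rho_t$ is applied belong to $\mathcal Z$. *)

theory Defs
  imports "HOL-Probability.Probability"
begin

definition atomless :: "'w measure \<Rightarrow> bool" where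
  "atomless P \<longleftrightarrow>
     (\<forall>A\<in>sets P. 0 < emeasure P A \<longrightarrow>
        (\<exists>B\<in>sets P. B \<subseteq> A \<and> 0 < emeasure P B \<and> emeasure P B < emeasure P A))"

definition same_law :: "'w measure \<Rightarrow> ('w \<Rightarrow> real) \<Rightarrow> ('w \<Rightarrow> real) \<Rightarrow> bool" where
  "same_law P Z W \<longleftrightarrow> distr P borel Z = distr P borel W"

text \<open>Random variables are represented by functions, not by almost-sure equivalence classes.\<close>

definition rv_space :: "'w measure \<Rightarrow> ('w \<Rightarrow> real) set \<Rightarrow> bool" where
  "rv_space P \<Z> \<longleftrightarrow>
     \<Z> \<subseteq> borel_measurable P \<and>
     (\<forall>a. (\<lambda>_. a) \<in> \<Z>) \<and>
     (\<forall>Z\<in>\<Z>. \<forall>W\<in>\<Z>. (\<lambda>w. Z w + W w) \<in> \<Z>) \<and>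
     (\<forall>a. \<forall>Z\<in>\<Z>. (\<lambda>w. a * Z w) \<in> \<Z>) \<and>
     (\<forall>Z\<in>\<Z>. \<forall>W\<in>borel_measurable P. same_law P Z W \<longrightarrow> W \<in> \<Z>)"

definition coherent :: "'w measure \<Rightarrow> ('w \<Rightarrow> real) set \<Rightarrow> (('w \<Rightarrow> real) \<Rightarrow> real) \<Rightarrow> bool" where
  "coherent P \<Z> r \<longleftrightarrow>
     (\<forall>Z\<in>\<Z>. \<forall>W\<in>\<Z>. \<forall>l\<in>{0..1}.
        r (\<lambda>w. l * Z w + (1 - l) * W w) \<le> l * r Z + (1 - l) * r W) \<and>
     (\<forall>Z\<in>\<Z>. \<forall>W\<in>\<Z>. (AE w in P. Z w \<le> W w) \<longrightarrow> r Z \<le> r W) \<and>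
     (\<forall>a. \<forall>W\<in>\<Z>. r (\<lambda>w. a + W w) = a + r W) \<and>
     (\<forall>l\<ge>0. \<forall>W\<in>\<Z>. r (\<lambda>w. l * W w) = l * r W)"

definition distribution_invariant ::
  "'w measure \<Rightarrow> ('w \<Rightarrow> real) set \<Rightarrow> (('w \<Rightarrow> real) \<Rightarrow> real) \<Rightarrow> bool" where
  "distribution_invariant P \<Z> r \<longleftrightarrow>
     (\<forall>Z\<in>\<Z>. \<forall>W\<in>\<Z>. same_law P Z W \<longrightarrow> r Z = r W)"

text \<open>
  Throughout, \<open>Y (Suc t) x\<close> is a random vector with the law of the state at time \<open>Suc t\<close>, given
  that the process is continued at time \<open>t\<close> in state \<open>x\<close>. All these vectors live on the same
  probability space as the arguments of the risk measures \<open>r t\<close>; since the latter are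
  distribution-invariant, the choice of representatives is immaterial.

  The backward recursions below are only meaningful at times \<open>t \<le> T\<close>.
\<close>

function value_fun ::
  "nat \<Rightarrow> (nat \<Rightarrow> 'x \<Rightarrow> real) \<Rightarrow> (nat \<Rightarrow> 'x \<Rightarrow> real) \<Rightarrow> (nat \<Rightarrow> ('w \<Rightarrow> real) \<Rightarrow> real) \<Rightarrow>
   (nat \<Rightarrow> 'x \<Rightarrow> 'w \<Rightarrow> 'x) \<Rightarrow> nat \<Rightarrow> 'x \<Rightarrow> real" where
  "value_fun T s c r Y t x =
     (if t < T
      then min (s t x) (c t x + r t (\<lambda>w. value_fun T s c r Y (Suc t) (Y (Suc t) x w)))
      else s T x)"
  by pat_completeness auto
termination by (relation "Wellfounded.measure (\<lambda>(T, s, c, r, Y, t, x). T - t)") auto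

declare value_fun.simps [simp del]

definition continuation_loss ::
  "nat \<Rightarrow> (nat \<Rightarrow> 'x \<Rightarrow> real) \<Rightarrow> (nat \<Rightarrow> 'x \<Rightarrow> real) \<Rightarrow> (nat \<Rightarrow> ('w \<Rightarrow> real) \<Rightarrow> real) \<Rightarrow>
   (nat \<Rightarrow> 'x \<Rightarrow> 'w \<Rightarrow> 'x) \<Rightarrow> nat \<Rightarrow> 'x \<Rightarrow> real" where
  "continuation_loss T s c r Y t x =
     r t (\<lambda>w. value_fun T s c r Y (Suc t) (Y (Suc t) x w)) + c t x - s t x"

definition one_step_loss ::
  "(nat \<Rightarrow> 'x \<Rightarrow> real) \<Rightarrow> (nat \<Rightarrow> 'x \<Rightarrow> real) \<Rightarrow> (nat \<Rightarrow> ('w \<Rightarrow> real) \<Rightarrow> real) \<Rightarrow>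
   (nat \<Rightarrow> 'x \<Rightarrow> 'w \<Rightarrow> 'x) \<Rightarrow> nat \<Rightarrow> 'x \<Rightarrow> real" where
  "one_step_loss s c r Y t x = r t (\<lambda>w. s (Suc t) (Y (Suc t) x w)) + c t x - s t x"

datatype action = Stop | Continue

text \<open>Only the decisions at times \<open>t < T\<close> and at states in the state space matter.\<close>

definition is_policy :: "'x measure \<Rightarrow> nat \<Rightarrow> (nat \<Rightarrow> 'x \<Rightarrow> action) \<Rightarrow> bool" where
  "is_policy S T d \<longleftrightarrow> (\<forall>t<T. d t \<in> S \<rightarrow>\<^sub>M count_space UNIV)"

function policy_risk ::
  "nat \<Rightarrow> (nat \<Rightarrow> 'x \<Rightarrow> real) \<Rightarrow> (nat \<Rightarrow> 'x \<Rightarrow> real) \<Rightarrow> (nat \<Rightarrow> ('w \<Rightarrow> real) \<Rightarrow> real) \<Rightarrow>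
   (nat \<Rightarrow> 'x \<Rightarrow> 'w \<Rightarrow> 'x) \<Rightarrow> (nat \<Rightarrow> 'x \<Rightarrow> action) \<Rightarrow> nat \<Rightarrow> 'x \<Rightarrow> real" where
  "policy_risk T s c r Y d t x =
     (if t < T
      then (case d t x of
              Stop \<Rightarrow> s t x
            | Continue \<Rightarrow> c t x + r t (\<lambda>w. policy_risk T s c r Y d (Suc t) (Y (Suc t) x w)))
      else s T x)"
  by pat_completeness auto
termination by (relation "Wellfounded.measure (\<lambda>(T, s, c, r, Y, d, t, x). T - t)") auto

declare policy_risk.simps [simp del]

definition optimal_policy ::
  "'x measure \<Rightarrow> nat \<Rightarrow> (nat \<Rightarrow> 'x \<Rightarrow> real) \<Rightarrow> (nat \<Rightarrow> 'x \<Rightarrow> real) \<Rightarrow>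
   (nat \<Rightarrow> ('w \<Rightarrow> real) \<Rightarrow> real) \<Rightarrow> (nat \<Rightarrow> 'x \<Rightarrow> 'w \<Rightarrow> 'x) \<Rightarrow> (nat \<Rightarrow> 'x \<Rightarrow> action) \<Rightarrow> bool" where
  "optimal_policy S T s c r Y d \<longleftrightarrow>
     is_policy S T d \<and>
     (\<forall>x\<in>space S. \<forall>d'. is_policy S T d' \<longrightarrow>
        policy_risk T s c r Y d 0 x \<le> policy_risk T s c r Y d' 0 x)"

definition look_ahead_policy ::
  "(nat \<Rightarrow> 'x \<Rightarrow> real) \<Rightarrow> (nat \<Rightarrow> 'x \<Rightarrow> real) \<Rightarrow> (nat \<Rightarrow> ('w \<Rightarrow> real) \<Rightarrow> real) \<Rightarrow>
   (nat \<Rightarrow> 'x \<Rightarrow> 'w \<Rightarrow> 'x) \<Rightarrow> nat \<Rightarrow> 'x \<Rightarrow> action" where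
  "look_ahead_policy s c r Y t x = (if one_step_loss s c r Y t x \<ge> 0 then Stop else Continue)"

end

theory Submission imports Defs begin

text \<open>
  Since $v \le s$, monotonicity gives $L_t \le M_t$, so $M_t(x) < 0$ forces $L_t(x) < 0$. If
  $M_t(x) \ge 0$, then even $L_t(x) = M_t(x)$: by absorption $M_{t+1} \ge 0$ almost surely after
  continuing, so $L_{t+1} \ge 0$ there by backward induction, that is, $v_{t+1} = s_{t+1}$ almost
  surely. Hence the look-ahead policy stops exactly where the dynamic programming equation does,
  and its risk is the value function, which bounds the risk of every policy from below.
\<close>

lemma coherent_mono:
  assumes "coherent P \<Z> \<rho>" "Z \<in> \<Z>" "W \<in> \<Z>" "AE w in P. Z w \<le> W w"
  shows "\<rho> Z \<le> \<rho> W"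
  using assms unfolding coherent_def by blast

text \<open>Random variables are functions here, so almost sure equality is weaker than equality;
  monotonicity used in both directions bridges the gap. This allows an almost sure identity to be
  substituted inside \<open>\<rho>\<close>.\<close>

lemma coherent_AE_cong:
  assumes "coherent P \<Z> \<rho>" "Z \<in> \<Z>" "W \<in> \<Z>" "AE w in P. Z w = W w"
  shows "\<rho> Z = \<rho> W"
proof (rule antisym)
  show "\<rho> Z \<le> \<rho> W"
    using assms(4) by (intro coherent_mono[OF assms(1-3)]) auto
  show "\<rho> W \<le> \<rho> Z"
    using assms(4) by (intro coherent_mono[OF assms(1,3,2)]) auto
qed

lemma value_fun_final: "value_fun T s c r Y T x = s T x"
  by (simp add: value_fun.simps)

lemma policy_risk_final: "policy_risk T s c r Y d T x = s T x"
  by (simp add: policy_risk.simps)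

lemma value_fun_le_stop: "t \<le> T \<Longrightarrow> value_fun T s c r Y t x \<le> s t x"
  by (cases "t = T") (simp_all add: value_fun.simps)

text \<open>Factoring \<open>s t x\<close> out of the minimum shows that the sign of the
  continuation loss alone decides between the two actions.\<close>

lemma value_fun_eq_min_loss:
  assumes "t < T"
  shows "value_fun T s c r Y t x = s t x + min 0 (continuation_loss T s c r Y t x)"
  \<comment> \<open>Fixing the time argument to \<open>t\<close> keeps the value at
    \<open>Suc t\<close> folded, as it occurs in the loss.\<close>
  using assms by (simp add: value_fun.simps[of _ _ _ _ _ t] continuation_loss_def min_def)

lemma policy_risk_Stop:
  assumes "t < T" "d t x = Stop"
  shows "policy_risk T s c r Y d t x = s t x"
  using assms by (simp add: policy_risk.simps[of _ _ _ _ _ _ t])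

lemma policy_risk_Continue:
  assumes "t < T" "d t x = Continue"
  shows "policy_risk T s c r Y d t x =
    c t x + r t (\<lambda>w. policy_risk T s c r Y d (Suc t) (Y (Suc t) x w))"
  using assms by (simp add: policy_risk.simps[of _ _ _ _ _ _ t])

text \<open>The stopping region at time \<open>t\<close> is a superlevel set of the measurable
  function \<open>one_step_loss s c r Y t\<close>.\<close>

lemma look_ahead_policy_is_policy:
  assumes "\<And>t. t < T \<Longrightarrow> one_step_loss s c r Y t \<in> borel_measurable S"
  shows "is_policy S T (look_ahead_policy s c r Y)"
  unfolding is_policy_def
proof (intro allI impI)
  fix t assume "t < T"
  note [measurable] = assms[OF this]
  show "look_ahead_policy s c r Y t \<in> S \<rightarrow>\<^sub>M count_space UNIV"
    unfolding look_ahead_policy_def by measurable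
qed

lemma continuation_loss_le_one_step_loss:
  assumes "t < T" "coherent P \<Z> (r t)"
    and "(\<lambda>w. s (Suc t) (Y (Suc t) x w)) \<in> \<Z>"
    and "(\<lambda>w. value_fun T s c r Y (Suc t) (Y (Suc t) x w)) \<in> \<Z>"
  shows "continuation_loss T s c r Y t x \<le> one_step_loss s c r Y t x"
proof -
  have "r t (\<lambda>w. value_fun T s c r Y (Suc t) (Y (Suc t) x w)) \<le> r t (\<lambda>w. s (Suc t) (Y (Suc t) x w))"
    using assms(1) by (intro coherent_mono[OF assms(2,4,3)]) (simp add: value_fun_le_stop)
  then show ?thesis
    by (simp add: continuation_loss_def one_step_loss_def)
qed

text \<open>The two losses differ only in the argument of \<open>r t\<close>, so it suffices that
  value and stopping cost agree almost surely one step later. The induction is on the remaining time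
  \<open>T - t\<close>, with \<open>x\<close> arbitrary because the hypothesis is used at the random
  successor state.\<close>

lemma continuation_loss_eq_one_step_loss:
  assumes coherent: "\<And>t. t < T \<Longrightarrow> coherent P \<Z> (r t)"
    and Y: "\<And>t x w. t < T \<Longrightarrow> x \<in> X \<Longrightarrow> w \<in> space P \<Longrightarrow> Y (Suc t) x w \<in> X"
    and s_in: "\<And>t x. t < T \<Longrightarrow> x \<in> X \<Longrightarrow> (\<lambda>w. s (Suc t) (Y (Suc t) x w)) \<in> \<Z>"
    and value_in: "\<And>t x. t < T \<Longrightarrow> x \<in> X \<Longrightarrow>
          (\<lambda>w. value_fun T s c r Y (Suc t) (Y (Suc t) x w)) \<in> \<Z>"
    and absorbing: "\<And>t x. Suc t < T \<Longrightarrow> x \<in> X \<Longrightarrow> one_step_loss s c r Y t x \<ge> 0 \<Longrightarrow>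
          AE w in P. one_step_loss s c r Y (Suc t) (Y (Suc t) x w) \<ge> 0"
    and "t < T" "x \<in> X" "one_step_loss s c r Y t x \<ge> 0"
  shows "continuation_loss T s c r Y t x = one_step_loss s c r Y t x"
  using assms(6-)
proof (induction "T - t" arbitrary: t x rule: less_induct)
  case less
  have "AE w in P. value_fun T s c r Y (Suc t) (Y (Suc t) x w) = s (Suc t) (Y (Suc t) x w)"
  proof (cases "Suc t < T")
    case True
    \<comment> \<open>\<open>AE_space\<close> supplies \<open>w \<in> space P\<close>, which places
      the successor state in \<open>X\<close>, where the induction hypothesis is available.\<close>
    show ?thesis
      using absorbing[OF True less.prems(2,3)] AE_space
    proof eventually_elim
      case (elim w)
      then have "continuation_loss T s c r Y (Suc t) (Y (Suc t) x w)
          = one_step_loss s c r Y (Suc t) (Y (Suc t) x w)"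
        using True less.prems by (intro less.hyps Y) auto
      \<comment> \<open>The loss at \<open>Suc t\<close> is nonnegative by absorption, so its
        minimum with 0 vanishes and the value is the stopping cost.\<close>
      with elim True show ?case
        by (simp add: value_fun_eq_min_loss)
    qed
  next
    case False
    \<comment> \<open>The last decision time, where the induction bottoms out: the value at
      \<open>T\<close> is the stopping cost by definition.\<close>
    then have "Suc t = T"
      using less.prems by simp
    then show ?thesis
      by (simp add: value_fun_final)
  qed
  from coherent_AE_cong[OF coherent value_in s_in this] less.prems show ?case
    by (simp add: continuation_loss_def one_step_loss_def)
qed

text \<open>Backward induction from \<open>T\<close>: monotonicity of \<open>r t\<close> carries the
  bound at \<open>Suc t\<close> over to the cost of continuing at \<open>t\<close>, and the value is
  at most the cost of whichever action \<open>d\<close> chooses.\<close>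

lemma value_fun_le_policy_risk:
  assumes coherent: "\<And>t. t < T \<Longrightarrow> coherent P \<Z> (r t)"
    and Y: "\<And>t x w. t < T \<Longrightarrow> x \<in> X \<Longrightarrow> w \<in> space P \<Longrightarrow> Y (Suc t) x w \<in> X"
    and value_in: "\<And>t x. t < T \<Longrightarrow> x \<in> X \<Longrightarrow>
          (\<lambda>w. value_fun T s c r Y (Suc t) (Y (Suc t) x w)) \<in> \<Z>"
    and risk_in: "\<And>t x. t < T \<Longrightarrow> x \<in> X \<Longrightarrow>
          (\<lambda>w. policy_risk T s c r Y d (Suc t) (Y (Suc t) x w)) \<in> \<Z>"
    and "t \<le> T" "x \<in> X"
  shows "value_fun T s c r Y t x \<le> policy_risk T s c r Y d t x"
  using assms(5-)
proof (induction t arbitrary: x rule: inc_induct)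
  case base
  show ?case by (simp add: value_fun_final policy_risk_final)
next
  case (step t)
  \<comment> \<open>The induction hypothesis covers only states in \<open>X\<close>; since
    \<open>Y (Suc t) x\<close> maps all of \<open>space P\<close> into \<open>X\<close>, it holds at
    every sample point.\<close>
  have "r t (\<lambda>w. value_fun T s c r Y (Suc t) (Y (Suc t) x w))
      \<le> r t (\<lambda>w. policy_risk T s c r Y d (Suc t) (Y (Suc t) x w))"
    using step by (intro coherent_mono[OF coherent value_in risk_in] AE_I2) (auto intro: Y)
  with step.hyps show ?case
    by (cases "d t x")
      (auto simp: value_fun.simps[of _ _ _ _ _ t] policy_risk_Stop policy_risk_Continue)
qed

text \<open>By \<open>stop\<close>, \<open>d\<close> chooses a minimizer in the dynamic programming
  equation at every state of \<open>X\<close>. At zero loss both actions cost the same, so sending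
  ties to \<open>Stop\<close> is harmless.\<close>

lemma policy_risk_eq_value_fun:
  assumes coherent: "\<And>t. t < T \<Longrightarrow> coherent P \<Z> (r t)"
    and Y: "\<And>t x w. t < T \<Longrightarrow> x \<in> X \<Longrightarrow> w \<in> space P \<Longrightarrow> Y (Suc t) x w \<in> X"
    and value_in: "\<And>t x. t < T \<Longrightarrow> x \<in> X \<Longrightarrow>
          (\<lambda>w. value_fun T s c r Y (Suc t) (Y (Suc t) x w)) \<in> \<Z>"
    and risk_in: "\<And>t x. t < T \<Longrightarrow> x \<in> X \<Longrightarrow>
          (\<lambda>w. policy_risk T s c r Y d (Suc t) (Y (Suc t) x w)) \<in> \<Z>"
    and stop: "\<And>t x. t < T \<Longrightarrow> x \<in> X \<Longrightarrow>
          d t x = Stop \<longleftrightarrow> continuation_loss T s c r Y t x \<ge> 0"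
    and "t \<le> T" "x \<in> X"
  shows "policy_risk T s c r Y d t x = value_fun T s c r Y t x"
  using assms(6-)
proof (induction t arbitrary: x rule: inc_induct)
  case base
  show ?case by (simp add: value_fun_final policy_risk_final)
next
  case (step t)
  have eq: "r t (\<lambda>w. policy_risk T s c r Y d (Suc t) (Y (Suc t) x w))
      = r t (\<lambda>w. value_fun T s c r Y (Suc t) (Y (Suc t) x w))"
    using step by (intro coherent_AE_cong[OF coherent risk_in value_in] AE_I2) (auto intro: Y)
  show ?case
  proof (cases "d t x")
    case Stop
    then have "continuation_loss T s c r Y t x \<ge> 0"
      using stop step by simp
    with Stop step.hyps show ?thesis
      by (simp add: policy_risk_Stop value_fun_eq_min_loss)
  next
    case Continue
    then have "continuation_loss T s c r Y t x < 0"
      using stop[of t x] step by simp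
    \<comment> \<open>A negative loss is its own minimum with 0, and adding \<open>s t x\<close>
      back leaves exactly the cost of continuing.\<close>
    with Continue step.hyps show ?thesis
      by (simp add: policy_risk_Continue value_fun_eq_min_loss eq continuation_loss_def)
  qed
qed

theorem theorem4:
  fixes X :: "(real ^ 'n) set"
    and T :: nat
    and Q :: "nat \<Rightarrow> real ^ 'n \<Rightarrow> (real ^ 'n) measure"
    and s c :: "nat \<Rightarrow> real ^ 'n \<Rightarrow> real"
    and P :: "'w measure"
    and \<Z> :: "('w \<Rightarrow> real) set"
    and r :: "nat \<Rightarrow> ('w \<Rightarrow> real) \<Rightarrow> real"
    and Y :: "nat \<Rightarrow> real ^ 'n \<Rightarrow> 'w \<Rightarrow> real ^ 'n"
  assumes T: "T \<ge> 1"
    and X: "X \<in> sets borel"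
    and Q: "\<And>t. t < T \<Longrightarrow>
          Q t \<in> restrict_space borel X \<rightarrow>\<^sub>M prob_algebra (restrict_space borel X)"
    and s: "\<And>t. t \<le> T \<Longrightarrow> s t \<in> borel_measurable (restrict_space borel X)"
    and c: "\<And>t. t < T \<Longrightarrow> c t \<in> borel_measurable (restrict_space borel X)"
    and P: "prob_space P" "atomless P"
    and rvs: "rv_space P \<Z>"
    and coherent: "\<And>t. t < T \<Longrightarrow> coherent P \<Z> (r t)"
    and law_inv: "\<And>t. t < T \<Longrightarrow> distribution_invariant P \<Z> (r t)"
    and Y: "\<And>t x. t < T \<Longrightarrow> x \<in> X \<Longrightarrow> Y (Suc t) x \<in> P \<rightarrow>\<^sub>M restrict_space borel X"
    and Y_law: "\<And>t x. t < T \<Longrightarrow> x \<in> X \<Longrightarrow>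
          distr P (restrict_space borel X) (Y (Suc t) x) = Q t x"
    and meas_value: "\<And>t. t \<le> T \<Longrightarrow>
          value_fun T s c r Y t \<in> borel_measurable (restrict_space borel X)"
    and meas_L: "\<And>t. t < T \<Longrightarrow>
          continuation_loss T s c r Y t \<in> borel_measurable (restrict_space borel X)"
    and meas_M: "\<And>t. t < T \<Longrightarrow>
          one_step_loss s c r Y t \<in> borel_measurable (restrict_space borel X)"
    and meas_J: "\<And>d t. is_policy (restrict_space borel X) T d \<Longrightarrow> t \<le> T \<Longrightarrow>
          policy_risk T s c r Y d t \<in> borel_measurable (restrict_space borel X)"
    and s_in: "\<And>t x. t < T \<Longrightarrow> x \<in> X \<Longrightarrow> (\<lambda>w. s (Suc t) (Y (Suc t) x w)) \<in> \<Z>"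
    and value_in: "\<And>t x. t < T \<Longrightarrow> x \<in> X \<Longrightarrow>
          (\<lambda>w. value_fun T s c r Y (Suc t) (Y (Suc t) x w)) \<in> \<Z>"
    and J_in: "\<And>d t x. is_policy (restrict_space borel X) T d \<Longrightarrow> t < T \<Longrightarrow> x \<in> X \<Longrightarrow>
          (\<lambda>w. policy_risk T s c r Y d (Suc t) (Y (Suc t) x w)) \<in> \<Z>"
    and absorbing: "\<And>t x. Suc t < T \<Longrightarrow> x \<in> X \<Longrightarrow> one_step_loss s c r Y t x \<ge> 0 \<Longrightarrow>
          AE w in P. one_step_loss s c r Y (Suc t) (Y (Suc t) x w) \<ge> 0"
  shows "(\<forall>t<T. \<forall>x\<in>X. sgn (one_step_loss s c r Y t x) = sgn (continuation_loss T s c r Y t x)) \<and>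
         optimal_policy (restrict_space borel X) T s c r Y (look_ahead_policy s c r Y)"
proof -
  let ?S = "restrict_space borel X" and ?d = "look_ahead_policy s c r Y"
  have Y': "Y (Suc t) x w \<in> X" if "t < T" "x \<in> X" "w \<in> space P" for t x w
    using measurable_space[OF Y[OF that(1,2)] that(3)] by (simp add: space_restrict_space)
  have eq: "continuation_loss T s c r Y t x = one_step_loss s c r Y t x"
    if "t < T" "x \<in> X" "one_step_loss s c r Y t x \<ge> 0" for t x
    using coherent Y' s_in value_in absorbing that by (rule continuation_loss_eq_one_step_loss)
  have le: "continuation_loss T s c r Y t x \<le> one_step_loss s c r Y t x"
    if "t < T" "x \<in> X" for t x
    using that(1) coherent[OF that(1)] s_in[OF that] value_in[OF that]
    by (rule continuation_loss_le_one_step_loss)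
  \<comment> \<open>If the one-step loss is negative, \<open>le\<close> makes both losses negative;
    otherwise \<open>eq\<close> makes them equal.\<close>
  have same_sgn: "sgn (one_step_loss s c r Y t x) = sgn (continuation_loss T s c r Y t x)"
    if "t < T" "x \<in> X" for t x
    using eq[OF that] le[OF that] by (cases "one_step_loss s c r Y t x \<ge> 0") auto
  have policy: "is_policy ?S T ?d"
    using meas_M by (rule look_ahead_policy_is_policy)
  \<comment> \<open>From left to right, \<open>eq\<close> transfers nonnegativity to the
    continuation loss; from right to left, \<open>le\<close> does the converse.\<close>
  have stop: "?d t x = Stop \<longleftrightarrow> continuation_loss T s c r Y t x \<ge> 0" if "t < T" "x \<in> X" for t x
    using eq[OF that] le[OF that] by (auto simp: look_ahead_policy_def)
  have "policy_risk T s c r Y ?d 0 x \<le> policy_risk T s c r Y d 0 x"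
    if "x \<in> X" "is_policy ?S T d" for x d
  proof -
    have "policy_risk T s c r Y ?d 0 x = value_fun T s c r Y 0 x"
      using coherent Y' value_in J_in[OF policy] stop le0 that(1) by (rule policy_risk_eq_value_fun)
    also have "\<dots> \<le> policy_risk T s c r Y d 0 x"
      using coherent Y' value_in J_in[OF that(2)] le0 that(1) by (rule value_fun_le_policy_risk)
    finally show ?thesis .
  qed
  with policy same_sgn show ?thesis
    by (auto simp: optimal_policy_def space_restrict_space)
qed

end
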